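(* (1) (Type I) If $\ell$ is odd then $\varphi_\ell^{G_{\mathrm{I}}}\equiv0$; if $\ell$ is even then $\widetilde{\varphi_\ell^{G_{\mathrm{I}}}}(x,y)=x^\ell+y^\ell+\frac{2}{2+\sqrt2^{\,\ell}}\sum_{0<j<\ell,\ j\equiv0\ (\mathrm{mod}\ 2)}\binom{\ell}{j}x^{\ell-j}y^j.$ (2) (Type III) If $\ell\not\equiv0\pmod 4$ then $\varphi_\ell^{G_{\mathrm{III}}}\equiv0$; if $\ell\equiv0\pmod4$ then $\widetilde{\varphi_\ell^{G_{\mathrm{III}}}}(x,y)=x^\ell+\frac{3}{3+\sqrt3^{\,\ell}}\sum_{0<j\le\ell,\ j\equiv0\ (\mathrm{mod}\ 3)}2^j\binom{\ell}{j}x^{\ell-j}y^j.$ (3) (Type IV) If $\ell$ is odd then $\varphi_\ell^{G_{\mathrm{IV}}}\equiv0$; if $\ell$ is even then $\widetilde{\varphi_\ell^{G_{\mathrm{IV}}}}(x,y)=x^\ell+\frac{2}{2+2^{\ell}}\sum_{0<j\le\ell,\ j\equiv0\ (\mathrm{mod}\ 2)}3^j\binom{\ell}{j}x^{\ell-j}y^j.$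
   Context: $G_{\mathrm{I}}=\left\langle \frac{1}{\sqrt2}\begin{pmatrix}1&1\\1&-1\end{pmatrix},\begin{pmatrix}1&0\\0&-1\end{pmatrix}\right\rangle$, $G_{\mathrm{III}}=\left\langle \frac{1}{\sqrt3}\begin{pmatrix}1&2\\1&-1\end{pmatrix},\begin{pmatrix}1&0\\0&e^{2\pi\sqrt{-1}/3}\end{pmatrix}\right\rangle$, $G_{\mathrm{IV}}=\left\langle \frac{1}{2}\begin{pmatrix}1&3\\1&-1\end{pmatrix},\begin{pmatrix}1&0\\0&-1\end{pmatrix}\right\rangle$ (finite matrix groups). For $\sigma=\begin{pmatrix}a&b\\c&d\end{pmatrix}$ put $\sigma x:=ax+by$, and for a nonnegative integer $\ell$ define $\varphi_\ell^{G_{\mathrm{X}}}(x,y)=\frac{1}{|G_{\mathrm{X}}|}\sum_{\sigma\in G_{\mathrm{X}}}(\sigma x)^\ell$. When $\varphi_\ell^{G_{\mathrm{X}}}\not\equiv0$, $\widetilde{\varphi_\ell^{G_{\mathrm{X}}}}$ is $\varphi_\ell^{G_{\mathrm{X}}}$ divided by its coefficient of $x^\ell$.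
   Formalization: In (1), the formula for even ℓ is stated only for ℓ > 0: at ℓ = 0 the normalized polynomial is 1, while the displayed right-hand side is x^0 + y^0 = 2. *)

theory Defs
  imports
    "HOL-Analysis.Analysis"
    "HOL-Computational_Algebra.Polynomial"
    "HOL-Number_Theory.Cong"
    "HOL-Algebra.Generated_Groups"
begin

definition GL2 :: "(complex^2^2) monoid" where
  "GL2 = \<lparr>carrier = {A. invertible A}, monoid.mult = (**), one = mat 1\<rparr>"

lemma group_GL2: "group GL2"
proof (rule groupI)
  fix A assume "A \<in> carrier GL2"
  then show "\<exists>B\<in>carrier GL2. B \<otimes>\<^bsub>GL2\<^esub> A = \<one>\<^bsub>GL2\<^esub>"
    by (auto simp: GL2_def invertible_def)
qed (auto simp: GL2_def matrix_mul_assoc invertible_det_nz det_mul)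

definition G_I :: "(complex^2^2) set" where
  "G_I = generate GL2
     {(1 / sqrt 2) *\<^sub>R vector [vector [1, 1], vector [1, -1]],
      vector [vector [1, 0], vector [0, -1]]}"

definition G_III :: "(complex^2^2) set" where
  "G_III = generate GL2
     {(1 / sqrt 3) *\<^sub>R vector [vector [1, 2], vector [1, -1]],
      vector [vector [1, 0], vector [0, exp (2 * of_real pi * \<i> / 3)]]}"

definition G_IV :: "(complex^2^2) set" where
  "G_IV = generate GL2
     {(1 / 2) *\<^sub>R vector [vector [1, 3], vector [1, -1]],
      vector [vector [1, 0], vector [0, -1]]}"

lemma generators_GL2:
  "(1 / sqrt 2) *\<^sub>R vector [vector [1, 1], vector [1, -1]] \<in> carrier GL2"
  "(1 / sqrt 3) *\<^sub>R vector [vector [1, 2], vector [1, -1]] \<in> carrier GL2"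
  "(1 / 2) *\<^sub>R vector [vector [1, 3], vector [1, -1]] \<in> carrier GL2"
  "vector [vector [1, 0], vector [0, -1]] \<in> carrier GL2"
  "vector [vector [1, 0], vector [0, exp (2 * of_real pi * \<i> / 3)]] \<in> carrier GL2"
  by (simp_all add: GL2_def invertible_det_nz det_2) (simp_all add: scaleR_conv_of_real field_simps)

lemma subgroup_G: "subgroup G_I GL2" "subgroup G_III GL2" "subgroup G_IV GL2"
  unfolding G_I_def G_III_def G_IV_def
  by (intro group.generate_is_subgroup[OF group_GL2]; use generators_GL2 in simp)+

(* C[x,y] as C[x][y]: the inner variable is x, the outer one y. *)

type_synonym bipoly = "complex poly poly"

definition Const :: "complex \<Rightarrow> bipoly" where "Const c = [:[:c:]:]"
definition X :: bipoly where "X = [:[:0, 1:]:]"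
definition Y :: bipoly where "Y = [:0, 1:]"

definition coeff_xy :: "bipoly \<Rightarrow> nat \<Rightarrow> nat \<Rightarrow> complex" where
  "coeff_xy p i j = coeff (coeff p j) i"

lemma coeff_xy_monomial:
  "coeff_xy (Const c * X ^ a * Y ^ b) i j = (if i = a \<and> j = b then c else 0)"
proof -
  have x: "[:0, 1:] ^ n = monom (1 :: 'a :: comm_semiring_1) n" for n
    by (simp add: monom_altdef)
  have "X ^ a = [:monom 1 a:]"
    by (simp add: X_def poly_const_pow x)
  then have "Const c * X ^ a * Y ^ b = monom (monom c a) b"
    by (simp add: Const_def Y_def x smult_monom)
  then show ?thesis by (simp add: coeff_xy_def)
qed

(* \<sigma>x = ax + by uses the first row (a, b) of \<sigma>, not the first column. *)
definition act_x :: "complex^2^2 \<Rightarrow> bipoly" where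
  "act_x \<sigma> = Const (\<sigma>$1$1) * X + Const (\<sigma>$1$2) * Y"

definition \<phi> :: "(complex^2^2) set \<Rightarrow> nat \<Rightarrow> bipoly" where
  "\<phi> G l = Const (1 / of_nat (card G)) * (\<Sum>\<sigma>\<in>G. act_x \<sigma> ^ l)"

(* Meaningful only if the coefficient of x^l is nonzero; otherwise this is 0, since 1 / 0 = 0. *)
definition \<phi>_normalized :: "(complex^2^2) set \<Rightarrow> nat \<Rightarrow> bipoly" where
  "\<phi>_normalized G l = Const (1 / coeff_xy (\<phi> G l) l 0) * \<phi> G l"

end

(* For a finite matrix group G the summand of phi depends only on the first row of sigma, and the
   first rows form the orbit of (1, 0) under right multiplication by G. All fibres of the map from
   sigma to its first row have the same size, so phi is a nonzero multiple of the sum of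
   (a x + b y)^l over the orbit. For the three groups the orbit is U * W with U the group of 2nd,
   4th and 2nd roots of unity respectively and W a small set of representatives. The sum therefore
   has the factor sum_{u in U} u^l, which decides when phi vanishes, and the binomial expansion of
   the sum over W gives the coefficients. *)
theory Submission
  imports Defs
begin

section \<open>Rows, scalar multiples and linear forms\<close>

definition row_mult :: "complex \<times> complex \<Rightarrow> complex^2^2 \<Rightarrow> complex \<times> complex" where
  "row_mult v A = (fst v * A$1$1 + snd v * A$2$1, fst v * A$1$2 + snd v * A$2$2)"

definition scale_pair :: "complex \<Rightarrow> complex \<times> complex \<Rightarrow> complex \<times> complex" where
  "scale_pair u v = (u * fst v, u * snd v)"

definition linear_form :: "complex \<times> complex \<Rightarrow> bipoly" where
  "linear_form v = Const (fst v) * X + Const (snd v) * Y"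

lemma row_mult_mat_1 [simp]: "row_mult v (mat 1) = v"
  by (simp add: row_mult_def mat_def)

lemma row_mult_mult: "row_mult v (A ** B) = row_mult (row_mult v A) B"
  by (simp add: row_mult_def matrix_matrix_mult_def sum_2 algebra_simps)

text \<open>Scalars commute with the action on rows, so a scaled row moves exactly as its
  representative does; closure of \<open>U * W\<close> can therefore be checked on \<open>W\<close>
  alone.\<close>

lemma row_mult_scale: "row_mult (scale_pair u v) A = scale_pair u (row_mult v A)"
  by (simp add: row_mult_def scale_pair_def algebra_simps)

lemma scale_scale: "scale_pair u (scale_pair v w) = scale_pair (u * v) w"
  by (simp add: scale_pair_def)

lemma act_x_eq: "act_x \<sigma> = linear_form (row_mult (1, 0) \<sigma>)"
  by (simp add: act_x_def linear_form_def row_mult_def)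

lemma Const_0 [simp]: "Const 0 = 0"
  and Const_1 [simp]: "Const 1 = 1"
  and Const_mult: "Const (a * b) = Const a * Const b"
  and Const_add: "Const (a + b) = Const a + Const b"
  by (simp_all add: Const_def one_pCons)

lemma Const_power: "Const (a ^ n) = Const a ^ n"
  by (induction n) (simp_all add: Const_mult)

lemma Const_of_nat: "Const (of_nat n) = of_nat n"
  by (induction n) (simp_all add: Const_add)

lemma Const_numeral: "Const (numeral n) = numeral n"
  using Const_of_nat[of "numeral n"] by simp

lemma Const_sum: "Const (sum f A) = (\<Sum>a\<in>A. Const (f a))"
  by (induction A rule: infinite_finite_induct) (simp_all add: Const_add)

lemma Const_eq_0_iff [simp]: "Const a = 0 \<longleftrightarrow> a = 0"
  by (simp add: Const_def)

lemma linear_form_scale: "linear_form (scale_pair u v) = Const u * linear_form v"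
  by (simp add: linear_form_def scale_pair_def Const_mult algebra_simps)

lemma coeff_xy_Const_mult: "coeff_xy (Const c * p) i j = c * coeff_xy p i j"
  by (simp add: coeff_xy_def Const_def)

lemma coeff_xy_sum: "coeff_xy (sum f A) i j = (\<Sum>a\<in>A. coeff_xy (f a) i j)"
  by (simp add: coeff_xy_def coeff_sum)

text \<open>Reads off the coefficient of x^l, the number by which the normalization divides.\<close>

lemma coeff_xy_homogeneous:
  "coeff_xy (\<Sum>j\<le>l. Const (f j) * X ^ (l - j) * Y ^ j) l 0 = f 0"
proof -
  have "coeff_xy (\<Sum>j\<le>l. Const (f j) * X ^ (l - j) * Y ^ j) l 0 =
      (\<Sum>j\<le>l. if j = 0 then f j else 0)"
    unfolding coeff_xy_sum coeff_xy_monomial by (intro sum.cong refl) auto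
  then show ?thesis by simp
qed

lemma linear_form_power:
  "linear_form v ^ l =
    (\<Sum>j\<le>l. Const (of_nat (l choose j) * (fst v ^ (l - j) * snd v ^ j)) * X ^ (l - j) * Y ^ j)"
proof -
  \<comment> \<open>\<open>binomial_ring\<close> gives the summation index to the first summand, so
    the Y term is put first to make j the exponent of Y.\<close>
  have "linear_form v ^ l = (Const (snd v) * Y + Const (fst v) * X) ^ l"
    by (simp add: linear_form_def add.commute)
  then show ?thesis
    unfolding binomial_ring
    by (simp add: Const_mult Const_power Const_of_nat power_mult_distrib mult_ac)
qed

lemma sum_linear_form_power:
  "(\<Sum>w\<in>W. linear_form w ^ l) =
    (\<Sum>j\<le>l. Const (of_nat (l choose j) * (\<Sum>w\<in>W. fst w ^ (l - j) * snd w ^ j)) * X ^ (l - j) * Y ^ j)"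
  unfolding linear_form_power
  by (subst sum.swap) (simp add: sum_distrib_left sum_distrib_right Const_sum)

section \<open>The orbit of (1, 0) and the average over a group generated by S\<close>

text \<open>The assumptions are finite checks on the generators. \<open>W_step\<close> keeps the
  orbit inside \<open>U * W\<close>, \<open>reach\<close> fills it, \<open>scale_inj\<close>
  prevents double counting, and \<open>W_spanning\<close> supplies a row independent of (1, 0), from
  which finiteness of the group follows.\<close>

locale row_orbit =
  fixes S :: "(complex^2^2) set" and U :: "complex set" and W :: "(complex \<times> complex) set"
  assumes S_carrier: "S \<subseteq> carrier GL2"
    and finite_U: "finite U" and finite_W: "finite W"
    and U_one: "1 \<in> U"
    and U_mult: "\<lbrakk>u \<in> U; v \<in> U\<rbrakk> \<Longrightarrow> u * v \<in> U"
    and W_e1: "(1, 0) \<in> W"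
    and W_spanning: "\<exists>w\<in>W. snd w \<noteq> 0"
    and W_step: "\<lbrakk>A \<in> S; w \<in> W\<rbrakk> \<Longrightarrow> \<exists>u\<in>U. \<exists>w'\<in>W. row_mult w A = scale_pair u w'"
    and scale_inj: "inj_on (case_prod scale_pair) (U \<times> W)"
    \<comment> \<open>Every set containing \<open>(1, 0)\<close> and closed under \<open>S\<close> contains \<open>U * W\<close>: the orbit is all of \<open>U * W\<close>.\<close>
    and reach: "\<lbrakk>(1, 0) \<in> R; \<And>A v. \<lbrakk>A \<in> S; v \<in> R\<rbrakk> \<Longrightarrow> row_mult v A \<in> R; u \<in> U; w \<in> W\<rbrakk>
      \<Longrightarrow> scale_pair u w \<in> R"
begin

abbreviation "G \<equiv> generate GL2 S"

definition "orbit = case_prod scale_pair ` (U \<times> W)"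

lemma finite_orbit: "finite orbit"
  by (simp add: orbit_def finite_U finite_W)

lemma W_orbit: "w \<in> W \<Longrightarrow> w \<in> orbit"
  using U_one by (force simp: orbit_def scale_pair_def)

lemma orbit_step:
  assumes "A \<in> S" "v \<in> orbit"
  shows "row_mult v A \<in> orbit"
proof -
  obtain u w where v: "u \<in> U" "w \<in> W" "v = scale_pair u w"
    using assms(2) by (auto simp: orbit_def)
  obtain u' w' where "u' \<in> U" "w' \<in> W" "row_mult w A = scale_pair u' w'"
    using W_step[OF assms(1) v(2)] by blast
  then show ?thesis
    using v U_mult by (force simp: row_mult_scale scale_scale orbit_def)
qed

lemma G_carrier: "G \<subseteq> carrier GL2"
  using group.generate_incl[OF group_GL2 S_carrier] .

lemma subgroup_G': "subgroup G GL2"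
  using group.generate_is_subgroup[OF group_GL2 S_carrier] .

lemma G_mult: "\<lbrakk>\<sigma> \<in> G; \<tau> \<in> G\<rbrakk> \<Longrightarrow> \<sigma> ** \<tau> \<in> G"
  using subgroup.m_closed[OF subgroup_G'] by (simp add: GL2_def)

lemma G_inverse:
  assumes "\<sigma> \<in> G"
  obtains \<tau> where "\<tau> \<in> G" "\<sigma> ** \<tau> = mat 1" "\<tau> ** \<sigma> = mat 1"
  using that[of "inv\<^bsub>GL2\<^esub> \<sigma>"] subgroup.m_inv_closed[OF subgroup_G' assms]
    group.r_inv[OF group_GL2, of \<sigma>] group.l_inv[OF group_GL2, of \<sigma>] assms G_carrier
  by (auto simp: GL2_def)

lemma orbit_G:
  assumes "\<sigma> \<in> G" "v \<in> orbit"
  shows "row_mult v \<sigma> \<in> orbit"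
  using assms
proof (induction arbitrary: v rule: generate.induct)
  case one
  then show ?case by (simp add: GL2_def)
next
  case (incl A)
  then show ?case by (rule orbit_step)
next
  case (inv A)
  \<comment> \<open>An injective self-map of the finite orbit is onto, so its inverse preserves the orbit as well.\<close>
  have "A \<in> G" using inv by (simp add: generate.incl)
  then have A: "A ** inv\<^bsub>GL2\<^esub> A = mat 1"
    using group.r_inv[OF group_GL2, of A] G_carrier by (auto simp: GL2_def)
  have cancel: "row_mult (row_mult w A) (inv\<^bsub>GL2\<^esub> A) = w" for w
    by (simp add: row_mult_mult[symmetric] A)
  have "inj_on (\<lambda>w. row_mult w A) orbit"
    by (metis cancel inj_onI)
  then have "(\<lambda>w. row_mult w A) ` orbit = orbit"
    by (intro endo_inj_surj finite_orbit) (use orbit_step inv in auto)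
  then obtain w where "w \<in> orbit" "v = row_mult w A"
    using inv by blast
  then show ?case by (simp add: cancel)
next
  case (eng \<sigma> \<tau>)
  then show ?case by (simp add: GL2_def row_mult_mult)
qed

lemma orbit_reach:
  assumes "v \<in> orbit"
  obtains \<sigma> where "\<sigma> \<in> G" "row_mult (1, 0) \<sigma> = v"
proof -
  obtain u w where v: "u \<in> U" "w \<in> W" "v = scale_pair u w"
    using assms by (auto simp: orbit_def)
  \<comment> \<open>The rows (1, 0) times elements of \<open>G\<close> contain (1, 0) and are closed
    under the generators, so they are a legitimate choice of \<open>R\<close>.\<close>
  have "scale_pair u w \<in> row_mult (1, 0) ` G"
  proof (rule reach)
    have "mat 1 \<in> G" using generate.one[of GL2 S] by (simp add: GL2_def)
    then show "(1, 0) \<in> row_mult (1, 0) ` G" by (force simp: image_iff)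
  next
    fix A v assume "A \<in> S" "v \<in> row_mult (1, 0) ` G"
    then obtain \<sigma> where "\<sigma> \<in> G" "v = row_mult (1, 0) \<sigma>" by blast
    moreover have "\<sigma> ** A \<in> G"
      using \<open>\<sigma> \<in> G\<close> \<open>A \<in> S\<close> by (blast intro: G_mult generate.incl)
    ultimately show "row_mult v A \<in> row_mult (1, 0) ` G"
      by (metis image_eqI row_mult_mult)
  qed (use v in auto)
  then obtain \<sigma> where "\<sigma> \<in> G" "row_mult (1, 0) \<sigma> = v"
    using v(3) by (metis imageE)
  then show ?thesis by (rule that)
qed

lemma finite_G: "finite G"
proof -
  \<comment> \<open>A matrix is determined by its action on two independent rows of the finite orbit.\<close>
  obtain w where w: "w \<in> W" "snd w \<noteq> 0" using W_spanning by blast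
  have "inj_on (\<lambda>\<sigma>. (row_mult (1, 0) \<sigma>, row_mult w \<sigma>)) G"
    using w(2) by (intro inj_onI) (auto simp: row_mult_def vec_eq_iff forall_2)
  moreover have "(\<lambda>\<sigma>. (row_mult (1, 0) \<sigma>, row_mult w \<sigma>)) ` G \<subseteq> orbit \<times> orbit"
    by (rule image_subsetI) (simp add: orbit_G W_orbit W_e1 w(1))
  ultimately show ?thesis
    using finite_orbit by (meson finite_SigmaI finite_subset finite_imageD)
qed

text \<open>The fibre over v is a right coset of the stabilizer of (1, 0): if \<open>\<tau>\<close>
  takes (1, 0) to v, right multiplication by its inverse \<open>\<rho>\<close> carries the fibre
  bijectively onto the stabilizer.\<close>

lemma card_fibre:
  assumes "v \<in> orbit"
  shows "card {\<sigma>\<in>G. row_mult (1, 0) \<sigma> = v} = card {\<sigma>\<in>G. row_mult (1, 0) \<sigma> = (1, 0)}"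
proof -
  obtain \<tau> where \<tau>: "\<tau> \<in> G" "row_mult (1, 0) \<tau> = v"
    using orbit_reach assms by blast
  obtain \<rho> where \<rho>: "\<rho> \<in> G" "\<tau> ** \<rho> = mat 1" "\<rho> ** \<tau> = mat 1"
    using G_inverse \<tau>(1) by blast
  have "row_mult v \<rho> = (1, 0)"
    using \<tau>(2) \<rho>(2) by (metis row_mult_mat_1 row_mult_mult)
  then have "bij_betw (\<lambda>\<sigma>. \<sigma> ** \<rho>)
      {\<sigma>\<in>G. row_mult (1, 0) \<sigma> = v} {\<sigma>\<in>G. row_mult (1, 0) \<sigma> = (1, 0)}"
    by (intro bij_betw_byWitness[where f' = "\<lambda>\<sigma>. \<sigma> ** \<tau>"])
       (use \<tau> \<rho> G_mult in \<open>auto simp: row_mult_mult matrix_mul_assoc[symmetric]\<close>)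
  then show ?thesis by (rule bij_betw_same_card)
qed

text \<open>The scalar is the order of the stabilizer of (1, 0) divided by the order of
  \<open>G\<close>. It does not depend on l, and since it cancels in the normalization only its
  being nonzero matters.\<close>

lemma phi_orbit:
  obtains c where "c \<noteq> 0" "\<And>l. \<phi> G l = Const c * (\<Sum>v\<in>orbit. linear_form v ^ l)"
proof -
  define k where "k = card {\<sigma>\<in>G. row_mult (1, 0) \<sigma> = (1, 0)}"
  have one: "mat 1 \<in> G" using generate.one[of GL2 S] by (simp add: GL2_def)
  \<comment> \<open>An infinite set has \<open>card\<close> 0, so finiteness of \<open>G\<close> is
    essential here; k is positive because the identity fixes (1, 0).\<close>
  then have k: "k \<noteq> 0" and cG: "card G \<noteq> 0"
    using finite_G by (auto simp: k_def card_eq_0_iff)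
  have "(\<Sum>\<sigma>\<in>G. act_x \<sigma> ^ l) = Const (of_nat k) * (\<Sum>v\<in>orbit. linear_form v ^ l)" for l
  proof -
    have "(\<Sum>\<sigma>\<in>G. act_x \<sigma> ^ l) =
        (\<Sum>v\<in>orbit. \<Sum>\<sigma> | \<sigma> \<in> G \<and> row_mult (1, 0) \<sigma> = v. act_x \<sigma> ^ l)"
      using orbit_G W_orbit W_e1
      by (intro sum.group[symmetric] finite_G finite_orbit) auto
    also have "\<dots> = (\<Sum>v\<in>orbit. \<Sum>\<sigma> | \<sigma> \<in> G \<and> row_mult (1, 0) \<sigma> = v. linear_form v ^ l)"
      by (intro sum.cong refl) (auto simp: act_x_eq)
    also have "\<dots> = (\<Sum>v\<in>orbit. of_nat k * linear_form v ^ l)"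
      by (intro sum.cong refl) (simp add: card_fibre k_def)
    finally show ?thesis by (simp add: sum_distrib_left Const_of_nat)
  qed
  then have "\<phi> G l = Const (of_nat k / of_nat (card G)) * (\<Sum>v\<in>orbit. linear_form v ^ l)" for l
    by (simp add: \<phi>_def divide_inverse Const_mult mult_ac)
  moreover have "(of_nat k / of_nat (card G) :: complex) \<noteq> 0"
    using k cG by simp
  ultimately show ?thesis using that by blast
qed

text \<open>By \<open>scale_inj\<close> each orbit vector is u * w for exactly one pair, and
  homogeneity of degree l pulls out u^l.\<close>

lemma sum_orbit:
  "(\<Sum>v\<in>orbit. linear_form v ^ l) = Const (\<Sum>u\<in>U. u ^ l) * (\<Sum>w\<in>W. linear_form w ^ l)"
proof -
  have "(\<Sum>v\<in>orbit. linear_form v ^ l) = (\<Sum>(u, w)\<in>U \<times> W. linear_form (scale_pair u w) ^ l)"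
    unfolding orbit_def by (subst sum.reindex[OF scale_inj]) (simp add: case_prod_unfold)
  also have "\<dots> = (\<Sum>u\<in>U. \<Sum>w\<in>W. Const (u ^ l) * linear_form w ^ l)"
    by (simp add: sum.cartesian_product linear_form_scale power_mult_distrib Const_power)
  finally show ?thesis
    by (simp add: Const_sum sum_distrib_left sum_distrib_right sum.swap[of _ U])
qed

lemma phi_eq_0: "(\<Sum>u\<in>U. u ^ l) = 0 \<Longrightarrow> \<phi> G l = 0"
  using phi_orbit sum_orbit by (metis Const_0 mult_zero_left mult_zero_right)

text \<open>The coefficient of x^l is a nonzero scalar times the moment \<open>m 0\<close>. That
  scalar multiplies every coefficient, so it cancels and only the ratios \<open>m j / m 0\<close>
  remain.\<close>

lemma phi_normalized:
  fixes l :: nat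
  defines "m \<equiv> \<lambda>j. \<Sum>w\<in>W. fst w ^ (l - j) * snd w ^ j"
  assumes "(\<Sum>u\<in>U. u ^ l) \<noteq> 0" and "m 0 \<noteq> 0"
  shows "\<phi> G l \<noteq> 0 \<and> \<phi>_normalized G l =
    (\<Sum>j\<le>l. Const (of_nat (l choose j) * (m j / m 0)) * X ^ (l - j) * Y ^ j)"
proof -
  define Q where "Q = (\<Sum>w\<in>W. linear_form w ^ l)"
  have Q: "Q = (\<Sum>j\<le>l. Const (of_nat (l choose j) * m j) * X ^ (l - j) * Y ^ j)"
    by (simp add: Q_def m_def sum_linear_form_power)
  have Q0: "coeff_xy Q l 0 = m 0"
    unfolding Q coeff_xy_homogeneous by simp
  obtain c where "c \<noteq> 0" "\<phi> G l = Const c * (\<Sum>v\<in>orbit. linear_form v ^ l)"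
    using phi_orbit by blast
  \<comment> \<open>The two scalars, from averaging over the group and from summing u^l over
    \<open>U\<close>, merge into one nonzero d.\<close>
  then obtain d where d: "d \<noteq> 0" "\<phi> G l = Const d * Q"
    using assms(2) that[of "c * (\<Sum>u\<in>U. u ^ l)"]
    by (simp add: sum_orbit Q_def Const_mult mult.assoc)
  have "Q \<noteq> 0"
    using Q0 assms(3) by (auto simp: coeff_xy_def)
  have "\<phi>_normalized G l = Const (1 / (d * m 0)) * Const d * Q"
    by (simp add: \<phi>_normalized_def d(2) coeff_xy_Const_mult Q0 mult.assoc)
  also have "Const (1 / (d * m 0)) * Const d = Const (1 / m 0)"
    using d(1) by (simp add: Const_mult[symmetric])
  finally have "\<phi>_normalized G l = Const (1 / m 0) * Q" .
  also have "\<dots> = (\<Sum>j\<le>l. Const (of_nat (l choose j) * (m j / m 0)) * X ^ (l - j) * Y ^ j)"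
    unfolding Q sum_distrib_left
    by (intro sum.cong refl) (simp add: divide_inverse Const_mult mult_ac)
  finally show ?thesis
    using d \<open>Q \<noteq> 0\<close> by simp
qed

end

section \<open>Uniqueness of representatives and the shape of the normalized sums\<close>

text \<open>The first nonzero coordinate of every w is a positive real, so in u * w that coordinate
  has modulus r and phase u. This recovers u, and w follows by cancelling it.\<close>

lemma inj_on_scale_pair:
  assumes "\<And>u. u \<in> U \<Longrightarrow> norm u = 1"
    and "\<And>w. w \<in> W \<Longrightarrow>
      (\<exists>r>0. fst w = of_real r) \<or> fst w = 0 \<and> (\<exists>r>0. snd w = of_real r)"
  shows "inj_on (case_prod scale_pair) (U \<times> W)"
proof -
  have unit: "u = u'" if "norm u = 1" "norm u' = 1" "r > 0" "r' > 0" "u * of_real r = u' * of_real r'"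
    for u u' :: complex and r r' :: real
  proof -
    have "norm (u * of_real r) = norm (u' * of_real r')" using that(5) by simp
    then have "r = r'" using that(1-4) by (simp add: norm_mult)
    then show ?thesis using that by simp
  qed
  show ?thesis
  proof (rule inj_onI, clarify)
    fix u a b u' a' b'
    assume u: "u \<in> U" "u' \<in> U" and w: "(a, b) \<in> W" "(a', b') \<in> W"
      and "scale_pair u (a, b) = scale_pair u' (a', b')"
    then have eq: "u * a = u' * a'" "u * b = u' * b'" by (auto simp: scale_pair_def)
    have n: "norm u = 1" "norm u' = 1" using assms(1) u by auto
    then have nz: "u \<noteq> 0" "u' \<noteq> 0" by auto
    have "u = u'"
    proof (cases "a = 0")
      case True
      then have "a' = 0" using eq(1) nz by simp
      then obtain r r' where "r > 0" "b = of_real r" "r' > 0" "b' = of_real r'"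
        using True assms(2)[OF w(1)] assms(2)[OF w(2)] by auto
      then show ?thesis using unit[OF n] eq(2) by blast
    next
      case False
      then have "a' \<noteq> 0" using eq(1) nz by auto
      then obtain r r' where "r > 0" "a = of_real r" "r' > 0" "a' = of_real r'"
        using False assms(2)[OF w(1)] assms(2)[OF w(2)] by auto
      then show ?thesis using unit[OF n] eq(1) by blast
    qed
    then show "u = u' \<and> (a, b) = (a', b')" using eq nz by auto
  qed
qed

text \<open>The shape for types III and IV, where only x^l stands apart from the sum.\<close>

lemma homogeneous_sum_pure_power:
  fixes f :: "nat \<Rightarrow> complex"
  assumes "f 0 = 1" and "\<And>j. \<lbrakk>0 < j; j \<le> l\<rbrakk> \<Longrightarrow> f j = (if P j then r * k ^ j else 0)"
  shows "(\<Sum>j\<le>l. Const (of_nat (l choose j) * f j) * X ^ (l - j) * Y ^ j) =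
    X ^ l + Const r * (\<Sum>j | 0 < j \<and> j \<le> l \<and> P j.
      Const k ^ j * of_nat (l choose j) * X ^ (l - j) * Y ^ j)"
proof -
  let ?h = "\<lambda>j. Const (of_nat (l choose j) * f j) * X ^ (l - j) * Y ^ j"
  let ?J = "{j. 0 < j \<and> j \<le> l \<and> P j}"
  have "(\<Sum>j\<le>l. ?h j) = (\<Sum>j\<in>insert 0 ?J. ?h j)"
    using assms(2) by (intro sum.mono_neutral_right) auto
  also have "\<dots> = ?h 0 + (\<Sum>j\<in>?J. ?h j)"
    by (subst sum.insert) auto
  also have "(\<Sum>j\<in>?J. ?h j) =
      (\<Sum>j\<in>?J. Const r * (Const k ^ j * of_nat (l choose j) * X ^ (l - j) * Y ^ j))"
    by (intro sum.cong refl) (auto simp: assms(2) Const_mult Const_power Const_of_nat mult_ac)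
  finally show ?thesis
    by (simp add: assms(1) sum_distrib_left)
qed

text \<open>The shape for type I, where both x^l and y^l stand apart. For l = 0 these two would be
  the same term j = 0 counted twice, giving 2 instead of 1.\<close>

lemma homogeneous_sum_pure_powers:
  fixes f :: "nat \<Rightarrow> complex"
  assumes "0 < l" "f 0 = 1" "f l = 1"
    and "\<And>j. \<lbrakk>0 < j; j < l\<rbrakk> \<Longrightarrow> f j = (if P j then r else 0)"
  shows "(\<Sum>j\<le>l. Const (of_nat (l choose j) * f j) * X ^ (l - j) * Y ^ j) =
    X ^ l + Y ^ l + Const r * (\<Sum>j | 0 < j \<and> j < l \<and> P j.
      of_nat (l choose j) * X ^ (l - j) * Y ^ j)"
proof -
  let ?h = "\<lambda>j. Const (of_nat (l choose j) * f j) * X ^ (l - j) * Y ^ j"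
  let ?J = "{j. 0 < j \<and> j < l \<and> P j}"
  have "(\<Sum>j\<le>l. ?h j) = (\<Sum>j\<in>insert 0 (insert l ?J). ?h j)"
    using assms(4) by (intro sum.mono_neutral_right) auto
  also have "\<dots> = ?h 0 + (?h l + (\<Sum>j\<in>?J. ?h j))"
    using assms(1) by simp
  also have "(\<Sum>j\<in>?J. ?h j) =
      (\<Sum>j\<in>?J. Const r * (of_nat (l choose j) * X ^ (l - j) * Y ^ j))"
    by (intro sum.cong refl) (auto simp: assms(4) Const_mult Const_of_nat mult_ac)
  finally show ?thesis
    by (simp add: assms(2,3) sum_distrib_left add.assoc)
qed

lemma scale_pair_one [simp]: "scale_pair 1 v = v"
  by (simp add: scale_pair_def)

text \<open>Both coordinates of a representative share one denominator r, which hence contributes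
  r^l for every j.\<close>

lemma power_split: "j \<le> l \<Longrightarrow> (a :: 'a :: monoid_mult) ^ (l - j) * a ^ j = a ^ l"
  by (simp add: power_add[symmetric])

section \<open>The generators and the orbits of the three groups\<close>

abbreviation M_I :: "complex^2^2" where
  "M_I \<equiv> (1 / sqrt 2) *\<^sub>R vector [vector [1, 1], vector [1, -1]]"
abbreviation M_III :: "complex^2^2" where
  "M_III \<equiv> (1 / sqrt 3) *\<^sub>R vector [vector [1, 2], vector [1, -1]]"
abbreviation M_IV :: "complex^2^2" where
  "M_IV \<equiv> (1 / 2) *\<^sub>R vector [vector [1, 3], vector [1, -1]]"
abbreviation D_2 :: "complex^2^2" where
  "D_2 \<equiv> vector [vector [1, 0], vector [0, -1]]"
abbreviation \<omega> :: complex where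
  "\<omega> \<equiv> exp (2 * of_real pi * \<i> / 3)"
abbreviation D_3 :: "complex^2^2" where
  "D_3 \<equiv> vector [vector [1, 0], vector [0, \<omega>]]"

lemma row_mult_gens:
  "row_mult (a, b) M_I = ((a + b) / sqrt 2, (a - b) / sqrt 2)"
  "row_mult (a, b) M_III = ((a + b) / sqrt 3, (2 * a - b) / sqrt 3)"
  "row_mult (a, b) M_IV = ((a + b) / 2, (3 * a - b) / 2)"
  "row_mult (a, b) D_2 = (a, - b)"
  "row_mult (a, b) D_3 = (a, \<omega> * b)"
  by (simp_all add: row_mult_def) (simp_all add: scaleR_conv_of_real field_simps)

lemma sqrt_mult_complex:
  "complex_of_real (sqrt 2) * sqrt 2 = 2" "complex_of_real (sqrt 3) * sqrt 3 = 3"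
  by (simp_all only: of_real_mult[symmetric] real_sqrt_mult_self) simp_all

text \<open>\<open>U * W\<close> consists of the eight vertices of a regular octagon;
  \<open>W\<close> has one vertex from each antipodal pair.\<close>

interpretation I: row_orbit "{M_I, D_2}" "{1, -1}"
  "{(1, 0), (0, 1), (1 / of_real (sqrt 2), 1 / of_real (sqrt 2)),
    (1 / of_real (sqrt 2), - 1 / of_real (sqrt 2))}"
proof -
  let ?s = "1 / complex_of_real (sqrt 2)"
  let ?W = "{(1, 0), (0, 1), (?s, ?s), (?s, - 1 / of_real (sqrt 2))} :: (complex \<times> complex) set"
  have M: "row_mult (1, 0) M_I = (?s, ?s)" "row_mult (0, 1) M_I = (?s, - 1 / of_real (sqrt 2))"
    "row_mult (?s, ?s) M_I = (1, 0)" "row_mult (?s, - 1 / of_real (sqrt 2)) M_I = (0, 1)"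
    by (simp_all add: row_mult_gens field_simps sqrt_mult_complex)
  have D: "row_mult (1, 0) D_2 = (1, 0)" "row_mult (0, 1) D_2 = scale_pair (-1) (0, 1)"
    "row_mult (?s, ?s) D_2 = (?s, - 1 / of_real (sqrt 2))" "row_mult (?s, - 1 / of_real (sqrt 2)) D_2 = (?s, ?s)"
    by (simp_all add: row_mult_gens scale_pair_def)
  show "row_orbit {M_I, D_2} {1, -1} ?W"
  proof
    fix A w assume "A \<in> {M_I, D_2}" "w \<in> ?W"
    then show "\<exists>u\<in>{1, -1}. \<exists>w'\<in>?W. row_mult w A = scale_pair u w'"
      using M D by (elim insertE emptyE; simp only:; simp)
  next
    show "inj_on (case_prod scale_pair) ({1, -1} \<times> ?W)"
      by (rule inj_on_scale_pair) (auto intro: exI[of _ "1::real"] exI[of _ "1 / sqrt 2"])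
  next
    fix R :: "(complex \<times> complex) set" and u :: complex and w
    assume R: "(1, 0) \<in> R" and "\<And>A v. \<lbrakk>A \<in> {M_I, D_2}; v \<in> R\<rbrakk> \<Longrightarrow> row_mult v A \<in> R"
      and uw: "u \<in> {1, -1}" "w \<in> ?W"
    then have step: "scale_pair u (row_mult v A) \<in> R"
      if "A \<in> {M_I, D_2}" "scale_pair u v \<in> R" for A u v
      using that by (metis row_mult_scale)
    have W: "scale_pair u w \<in> R" if "scale_pair u (1, 0) \<in> R" "w \<in> ?W" for u w
    proof -
      have "scale_pair u (?s, ?s) \<in> R"
        using step[of M_I u "(1, 0)"] that(1) M by simp
      moreover from this have "scale_pair u (?s, - 1 / of_real (sqrt 2)) \<in> R"
        using step[of D_2 u "(?s, ?s)"] D by simp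
      moreover from this have "scale_pair u (0, 1) \<in> R"
        using step[of M_I u "(?s, - 1 / of_real (sqrt 2))"] M by simp
      ultimately show ?thesis using that by auto
    qed
    \<comment> \<open>The sign enters because \<open>D_2\<close> negates (0, 1). The chain of
      \<open>W\<close> is then walked backwards to reach -(1, 0).\<close>
    have "scale_pair (-1) (0, 1) \<in> R"
      using step[of D_2 1 "(0, 1)"] W[of 1 "(0, 1)"] R D by simp
    then have "scale_pair (-1) (?s, - 1 / of_real (sqrt 2)) \<in> R"
      using step[of M_I "-1" "(0, 1)"] M by simp
    then have "scale_pair (-1) (?s, ?s) \<in> R"
      using step[of D_2 "-1" "(?s, - 1 / of_real (sqrt 2))"] D by simp
    then have "scale_pair (-1) (1, 0) \<in> R"
      using step[of M_I "-1" "(?s, ?s)"] M by simp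
    then have "scale_pair u (1, 0) \<in> R"
      using uw(1) R by auto
    then show "scale_pair u w \<in> R"
      using uw(2) by (rule W)
  qed (use generators_GL2 in auto)
qed

text \<open>After dividing the second coordinate by sqrt 3, \<open>U * W\<close> is the set of
  vertices of a regular hexagon.\<close>

interpretation IV: row_orbit "{M_IV, D_2}" "{1, -1}" "{(1, 0), (1 / 2, 3 / 2), (1 / 2, - 3 / 2)}"
proof -
  let ?W = "{(1, 0), (1 / 2, 3 / 2), (1 / 2, - 3 / 2)} :: (complex \<times> complex) set"
  have M: "row_mult (1, 0) M_IV = (1 / 2, 3 / 2)" "row_mult (1 / 2, 3 / 2) M_IV = (1, 0)"
    "row_mult (1 / 2, - 3 / 2) M_IV = scale_pair (-1) (1 / 2, - 3 / 2)"
    by (simp_all add: row_mult_gens scale_pair_def)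
  have D: "row_mult (1, 0) D_2 = (1, 0)" "row_mult (1 / 2, 3 / 2) D_2 = (1 / 2, - 3 / 2)"
    "row_mult (1 / 2, - 3 / 2) D_2 = (1 / 2, 3 / 2)"
    by (simp_all add: row_mult_gens)
  show "row_orbit {M_IV, D_2} {1, -1} ?W"
  proof
    fix A w assume "A \<in> {M_IV, D_2}" "w \<in> ?W"
    then show "\<exists>u\<in>{1, -1}. \<exists>w'\<in>?W. row_mult w A = scale_pair u w'"
      using M D by (elim insertE emptyE; simp only:; simp)
  next
    show "inj_on (case_prod scale_pair) ({1, -1} \<times> ?W)"
      by (rule inj_on_scale_pair) (auto intro: exI[of _ "1::real"] exI[of _ "1 / 2 :: real"])
  next
    fix R :: "(complex \<times> complex) set" and u :: complex and w
    assume R: "(1, 0) \<in> R" and "\<And>A v. \<lbrakk>A \<in> {M_IV, D_2}; v \<in> R\<rbrakk> \<Longrightarrow> row_mult v A \<in> R"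
      and uw: "u \<in> {1, -1}" "w \<in> ?W"
    then have step: "scale_pair u (row_mult v A) \<in> R"
      if "A \<in> {M_IV, D_2}" "scale_pair u v \<in> R" for A u v
      using that by (metis row_mult_scale)
    have W: "scale_pair u w \<in> R" if "scale_pair u (1, 0) \<in> R" "w \<in> ?W" for u w
    proof -
      have "scale_pair u (1 / 2, 3 / 2) \<in> R"
        using step[of M_IV u "(1, 0)"] that(1) M by simp
      moreover from this have "scale_pair u (1 / 2, - 3 / 2) \<in> R"
        using step[of D_2 u "(1 / 2, 3 / 2)"] D by simp
      ultimately show ?thesis using that by auto
    qed
    \<comment> \<open>Here \<open>M_IV\<close> itself negates (1/2, -3/2), and the way back to -(1,
      0) uses \<open>D_2\<close> and \<open>M_IV\<close>.\<close>
    have "scale_pair (-1) (1 / 2, - 3 / 2) \<in> R"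
      using step[of M_IV 1 "(1 / 2, - 3 / 2)"] W[of 1 "(1 / 2, - 3 / 2)"] R M by simp
    then have "scale_pair (-1) (1 / 2, 3 / 2) \<in> R"
      using step[of D_2 "-1" "(1 / 2, - 3 / 2)"] D by simp
    then have "scale_pair (-1) (1, 0) \<in> R"
      using step[of M_IV "-1" "(1 / 2, 3 / 2)"] M by simp
    then have "scale_pair u (1, 0) \<in> R"
      using uw(1) R by auto
    then show "scale_pair u w \<in> R"
      using uw(2) by (rule W)
  qed (use generators_GL2 in auto)
qed

lemma omega_eq: "\<omega> = (- 1 + \<i> * sqrt 3) / 2"
proof -
  have "\<omega> = cis (2 * pi / 3)" by (simp add: cis_conv_exp mult_ac)
  then show ?thesis by (simp add: complex_eq_iff cos_120 sin_120)
qed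

lemma omega_cube: "\<omega> ^ 3 = 1"
  using exp_two_pi_i by (simp add: mult_ac flip: exp_of_nat_mult)

lemma one_plus_omega: "1 + \<omega> + \<omega>\<^sup>2 = 0"
  unfolding omega_eq by (simp add: complex_eq_iff power2_eq_square)

text \<open>The ratios of second to first coordinate on \<open>W\<close> are 0, 2, 2
  \<open>\<omega>\<close> and 2 \<open>\<omega>\<^sup>2\<close>; divided by sqrt 2 they are the
  vertices of a regular tetrahedron on the Riemann sphere.\<close>

interpretation III: row_orbit "{M_III, D_3}" "{1, -1, \<i>, - \<i>}"
  "{(1, 0), (1 / of_real (sqrt 3), 2 / of_real (sqrt 3)),
    (1 / of_real (sqrt 3), 2 * \<omega> / of_real (sqrt 3)),
    (1 / of_real (sqrt 3), 2 * \<omega>\<^sup>2 / of_real (sqrt 3))}"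
proof -
  define w0 w1 w2 :: "complex \<times> complex"
    where w_def: "w0 = (1 / of_real (sqrt 3), 2 / of_real (sqrt 3))"
      "w1 = (1 / of_real (sqrt 3), 2 * \<omega> / of_real (sqrt 3))"
      "w2 = (1 / of_real (sqrt 3), 2 * \<omega>\<^sup>2 / of_real (sqrt 3))"
  let ?W = "{(1, 0), w0, w1, w2}" and ?U = "{1, -1, \<i>, - \<i>}"
  \<comment> \<open>The fourth roots of unity come from 1 + 2 \<open>\<omega>\<close> =
    \<open>\<i>\<close> sqrt 3 and its complex conjugate.\<close>
  have M: "row_mult (1, 0) M_III = w0" "row_mult w0 M_III = (1, 0)"
    "row_mult w1 M_III = scale_pair \<i> w2" "row_mult w2 M_III = scale_pair (- \<i>) w1"
    by (simp_all add: w_def row_mult_gens) (simp_all add: omega_eq scale_pair_def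
      complex_eq_iff power2_eq_square)
  have D: "row_mult (1, 0) D_3 = (1, 0)" "row_mult w0 D_3 = w1"
    "row_mult w1 D_3 = w2" "row_mult w2 D_3 = w0"
    using omega_cube by (simp_all add: w_def row_mult_gens) (simp_all add: power2_eq_square power3_eq_cube mult.assoc)
  have "row_orbit {M_III, D_3} ?U ?W"
  proof
    fix A w assume "A \<in> {M_III, D_3}" "w \<in> ?W"
    then show "\<exists>u\<in>?U. \<exists>w'\<in>?W. row_mult w A = scale_pair u w'"
      using M D by (elim insertE emptyE; simp only:; simp)
  next
    show "inj_on (case_prod scale_pair) (?U \<times> ?W)"
      by (rule inj_on_scale_pair)
        (auto simp: w_def intro: exI[of _ "1::real"] exI[of _ "1 / sqrt 3"])
  next
    fix R :: "(complex \<times> complex) set" and u :: complex and w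
    assume R: "(1, 0) \<in> R" and "\<And>A v. \<lbrakk>A \<in> {M_III, D_3}; v \<in> R\<rbrakk> \<Longrightarrow> row_mult v A \<in> R"
      and uw: "u \<in> ?U" "w \<in> ?W"
    then have step: "scale_pair u (row_mult v A) \<in> R"
      if "A \<in> {M_III, D_3}" "scale_pair u v \<in> R" for A u v
      using that by (metis row_mult_scale)
    have W: "scale_pair u w \<in> R" if "scale_pair u (1, 0) \<in> R" "w \<in> ?W" for u w
    proof -
      have "scale_pair u w0 \<in> R"
        using step[of M_III u "(1, 0)"] that(1) M by simp
      moreover from this have "scale_pair u w1 \<in> R"
        using step[of D_3 u w0] D by simp
      moreover from this have "scale_pair u w2 \<in> R"
        using step[of D_3 u w1] D by simp
      ultimately show ?thesis using that by auto
    qed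
    \<comment> \<open>The path \<open>w1\<close>, \<open>\<i>\<close> \<open>w2\<close>,
      \<open>\<i>\<close> \<open>w0\<close>, \<open>\<i>\<close> (1, 0) under \<open>M_III\<close>,
      \<open>D_3\<close>, \<open>M_III\<close> multiplies by \<open>\<i>\<close>. Three such turns
      starting at u = 1 reach all of \<open>U\<close>.\<close>
    have turn: "scale_pair (u * \<i>) (1, 0) \<in> R" if "scale_pair u (1, 0) \<in> R" for u
    proof -
      have "scale_pair (u * \<i>) w2 \<in> R"
        using step[of M_III u w1] W[OF that, of w1] M by (simp add: scale_scale)
      then have "scale_pair (u * \<i>) w0 \<in> R"
        using step[of D_3 "u * \<i>" w2] D by simp
      then show ?thesis
        using step[of M_III "u * \<i>" w0] M by simp
    qed
    have "scale_pair u (1, 0) \<in> R"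
      using uw(1) R turn[of 1] turn[of \<i>] turn[of "-1"] by auto
    then show "scale_pair u w \<in> R"
      using uw(2) by (rule W)
  qed (use generators_GL2 in \<open>auto simp: w_def\<close>)
  then show "row_orbit {M_III, D_3} ?U
      {(1, 0), (1 / of_real (sqrt 3), 2 / of_real (sqrt 3)),
        (1 / of_real (sqrt 3), 2 * \<omega> / of_real (sqrt 3)),
        (1 / of_real (sqrt 3), 2 * \<omega>\<^sup>2 / of_real (sqrt 3))}"
    by (simp only: w_def)
qed

section \<open>Power sums of roots of unity\<close>

lemma sum_powers_2: "(\<Sum>u\<in>{1, -1 :: complex}. u ^ l) = (if even l then 2 else 0)"
  by auto

text \<open>For odd l the powers of u and -u cancel; for l = 2k the sum is 2 + 2 (-1)^k.\<close>

lemma sum_powers_4: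
  "(\<Sum>u\<in>{1, -1, \<i>, - \<i>}. u ^ l) = (if [l = 0] (mod 4) then 4 else 0)"
proof -
  have distinct: "(-1 :: complex) \<noteq> \<i>" "(-1 :: complex) \<noteq> - \<i>" "(1 :: complex) \<noteq> \<i>" "(1 :: complex) \<noteq> - \<i>"
    by (simp_all add: complex_eq_iff)
  have sum: "(\<Sum>u\<in>{1, -1, \<i>, - \<i>}. u ^ l) = 1 + (-1) ^ l + \<i> ^ l + (- \<i>) ^ l"
    using distinct by simp
  show ?thesis
  proof (cases "even l")
    case True
    then obtain k where k: "l = 2 * k" by blast
    have "4 dvd l \<longleftrightarrow> even k" unfolding k by presburger
    then show ?thesis
      unfolding sum by (simp add: k cong_0_iff power_mult)
  next
    case False
    then have "\<not> 4 dvd l" by presburger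
    then show ?thesis
      unfolding sum using False by (simp add: cong_0_iff)
  qed
qed

text \<open>Exponents matter only modulo 3, and for j congruent to 1 or 2 the terms are 1,
  \<open>\<omega>\<close>, \<open>\<omega>\<^sup>2\<close> in some order.\<close>

lemma sum_powers_omega: "1 + \<omega> ^ j + (\<omega>\<^sup>2) ^ j = (if [j = 0] (mod 3) then 3 else 0)"
proof -
  have *: "\<omega> ^ n = \<omega> ^ (n mod 3)" for n
  proof -
    have "\<omega> ^ (3 * (n div 3) + n mod 3) = \<omega> ^ (n mod 3)"
      by (simp only: power_add power_mult omega_cube power_one mult_1)
    then show ?thesis by simp
  qed
  have sq: "(\<omega>\<^sup>2) ^ j = \<omega> ^ (2 * j mod 3)"
    by (simp only: power_mult[symmetric] *[symmetric])
  have sum: "1 + \<omega> ^ j + (\<omega>\<^sup>2) ^ j = 1 + \<omega> ^ (j mod 3) + \<omega> ^ (2 * j mod 3)"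
    unfolding sq by (simp only: *[of j])
  have double: "2 * j mod 3 = 2 * (j mod 3) mod 3"
    by (simp add: mod_mult_right_eq)
  have "j mod 3 < 3" by simp
  then consider "j mod 3 = 0" | "j mod 3 = 1" | "j mod 3 = 2" by linarith
  then show ?thesis
    unfolding sum double using one_plus_omega by cases (simp_all add: cong_def power2_eq_square add_ac)
qed

section \<open>Moments of the representatives and the normalized polynomials\<close>

lemma G_I_normalized:
  assumes "even l" "0 < l"
  shows "\<phi> G_I l \<noteq> 0 \<and>
    \<phi>_normalized G_I l =
      X ^ l + Y ^ l + Const (of_real (2 / (2 + sqrt 2 ^ l))) *
        (\<Sum>j | 0 < j \<and> j < l \<and> [j = 0] (mod 2). of_nat (l choose j) * X ^ (l - j) * Y ^ j)"
proof -
  define t where "t = sqrt 2 ^ l"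
  define m :: "nat \<Rightarrow> complex" where "m j = (\<Sum>w\<in>{(1, 0), (0, 1),
    (1 / of_real (sqrt 2), 1 / of_real (sqrt 2)), (1 / of_real (sqrt 2), - 1 / of_real (sqrt 2))}.
    fst w ^ (l - j) * snd w ^ j)" for j
  have "t > 0" by (simp add: t_def)
  then have nz: "complex_of_real t \<noteq> 0" "2 + complex_of_real t \<noteq> 0"
    by (simp_all add: complex_eq_iff)
  \<comment> \<open>The powers of 0 are the contributions of (1, 0) and (0, 1): since
    \<open>0 ^ 0 = 1\<close>, they count only at j = 0 and at j = l respectively.\<close>
  have m: "m j = 0 ^ j + 0 ^ (l - j) + (1 + (-1) ^ j) / of_real t" if "j \<le> l" for j
  proof -
    have s: "(1 / complex_of_real (sqrt 2)) ^ (l - j) * (1 / of_real (sqrt 2)) ^ j = 1 / of_real t"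
      by (simp only: power_split[OF that]) (simp add: t_def power_one_over)
    have "(1 / complex_of_real (sqrt 2)) ^ (l - j) * (c / of_real (sqrt 2)) ^ j = c ^ j / of_real t" for c
    proof -
      have "(1 / complex_of_real (sqrt 2)) ^ (l - j) * (c / of_real (sqrt 2)) ^ j =
          c ^ j * ((1 / complex_of_real (sqrt 2)) ^ (l - j) * (1 / of_real (sqrt 2)) ^ j)"
        by (simp add: power_divide)
      then show ?thesis unfolding s by simp
    qed
    note c = this[of 1] this[of "-1"]
    moreover have "m j = 0 ^ j + 0 ^ (l - j) +
       ((1 / complex_of_real (sqrt 2)) ^ (l - j) * (1 / of_real (sqrt 2)) ^ j +
        (1 / complex_of_real (sqrt 2)) ^ (l - j) * (- 1 / of_real (sqrt 2)) ^ j)"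
      unfolding m_def by (subst sum.insert; simp)+
    ultimately show ?thesis
      unfolding c by (simp add: add_divide_distrib)
  qed
  have m0: "m 0 = (2 + of_real t) / of_real t"
    using m[of 0] assms(2) nz by (simp add: field_simps)
  have f: "m j / m 0 = (if [j = 0] (mod 2) then complex_of_real (2 / (2 + t)) else 0)"
    if "0 < j" "j < l" for j
    using m[of j] that nz by (auto simp: m0 cong_0_iff power_0_left)
  \<comment> \<open>As l is even, (-1)^l = 1, and (0, 1) contributes at j = l what (1, 0)
    contributes at j = 0. Hence y^l gets coefficient 1.\<close>
  have "m l = m 0"
    using m[of l] m[of 0] assms by (simp add: power_0_left)
  then have ml: "m l / m 0 = 1"
    using m0 nz by simp
  have "G_I = I.G" by (simp add: G_I_def)
  then show ?thesis
    using I.phi_normalized[of l, folded m_def] assms nz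
      homogeneous_sum_pure_powers[of l "\<lambda>j. m j / m 0" "\<lambda>j. [j = 0] (mod 2)"
        "complex_of_real (2 / (2 + t))", OF assms(2) _ ml f]
    by (simp add: sum_powers_2 m0 t_def del: of_real_divide of_real_add of_real_power)
qed

text \<open>No representative is a multiple of (0, 1), so y^l gets no extra contribution and j = l
  belongs to the sum; l = 0 is covered as well.\<close>

lemma G_IV_normalized:
  assumes "even l"
  shows "\<phi> G_IV l \<noteq> 0 \<and>
    \<phi>_normalized G_IV l =
      X ^ l + Const (of_real (2 / (2 + 2 ^ l))) *
        (\<Sum>j | 0 < j \<and> j \<le> l \<and> [j = 0] (mod 2). 3 ^ j * of_nat (l choose j) * X ^ (l - j) * Y ^ j)"
proof -
  define t :: real where "t = 2 ^ l"
  define m :: "nat \<Rightarrow> complex" where "m j = (\<Sum>w\<in>{(1, 0), (1 / 2, 3 / 2), (1 / 2, - 3 / 2)}.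
    fst w ^ (l - j) * snd w ^ j)" for j
  have "t > 0" by (simp add: t_def)
  then have nz: "complex_of_real t \<noteq> 0" "2 + complex_of_real t \<noteq> 0"
    by (simp_all add: complex_eq_iff)
  have m: "m j = 0 ^ j + 3 ^ j * (1 + (-1) ^ j) / of_real t" if "j \<le> l" for j
  proof -
    have s: "(1 / 2 :: complex) ^ (l - j) * (1 / 2) ^ j = 1 / of_real t"
      by (simp only: power_split[OF that]) (simp add: t_def power_one_over)
    have "(1 / 2 :: complex) ^ (l - j) * (c / 2) ^ j = c ^ j / of_real t" for c
    proof -
      have "(1 / 2 :: complex) ^ (l - j) * (c / 2) ^ j = c ^ j * ((1 / 2) ^ (l - j) * (1 / 2) ^ j)"
        by (simp add: power_divide)
      then show ?thesis unfolding s by simp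
    qed
    note c = this[of 3] this[of "-3"]
    have "m j = 0 ^ j + ((1 / 2) ^ (l - j) * (3 / 2) ^ j + (1 / 2) ^ (l - j) * (- 3 / 2) ^ j)"
      unfolding m_def by (subst sum.insert; simp)+
    moreover have "(- 3 :: complex) ^ j = 3 ^ j * (-1) ^ j"
      by (simp flip: power_mult_distrib)
    ultimately show ?thesis
      unfolding c by (simp add: add_divide_distrib distrib_left)
  qed
  have m0: "m 0 = (2 + of_real t) / of_real t"
    using m[of 0] nz by (simp add: field_simps)
  have f: "m j / m 0 = (if [j = 0] (mod 2) then complex_of_real (2 / (2 + t)) * 3 ^ j else 0)"
    if "0 < j" "j \<le> l" for j
    using m[of j] that nz by (auto simp: m0 cong_0_iff power_0_left)
  have "G_IV = IV.G" by (simp add: G_IV_def)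
  then show ?thesis
    using IV.phi_normalized[of l, folded m_def] assms nz
      homogeneous_sum_pure_power[of "\<lambda>j. m j / m 0" l "\<lambda>j. [j = 0] (mod 2)"
        "complex_of_real (2 / (2 + t))" 3, OF _ f]
    by (simp add: sum_powers_2 m0 t_def Const_numeral del: of_real_divide of_real_add of_real_power)
qed

lemma G_III_normalized:
  assumes "[l = 0] (mod 4)"
  shows "\<phi> G_III l \<noteq> 0 \<and>
    \<phi>_normalized G_III l =
      X ^ l + Const (of_real (3 / (3 + sqrt 3 ^ l))) *
        (\<Sum>j | 0 < j \<and> j \<le> l \<and> [j = 0] (mod 3). 2 ^ j * of_nat (l choose j) * X ^ (l - j) * Y ^ j)"
proof -
  define t where "t = sqrt 3 ^ l"
  define m :: "nat \<Rightarrow> complex" where "m j = (\<Sum>w\<in>{(1, 0), (1 / of_real (sqrt 3), 2 / of_real (sqrt 3)),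
    (1 / of_real (sqrt 3), 2 * \<omega> / of_real (sqrt 3)),
    (1 / of_real (sqrt 3), 2 * \<omega>\<^sup>2 / of_real (sqrt 3))}. fst w ^ (l - j) * snd w ^ j)" for j
  have "t > 0" by (simp add: t_def)
  then have nz: "complex_of_real t \<noteq> 0" "3 + complex_of_real t \<noteq> 0"
    by (simp_all add: complex_eq_iff)
  \<comment> \<open>Distinctness keeps the three representatives apart, so that the sum over the set
    \<open>W\<close> really has all their terms.\<close>
  have distinct: "\<omega> \<noteq> 1" "\<omega>\<^sup>2 \<noteq> 1" "\<omega>\<^sup>2 \<noteq> \<omega>"
    unfolding omega_eq by (simp_all add: complex_eq_iff power2_eq_square)
  have m: "m j = 0 ^ j + 2 ^ j * (if [j = 0] (mod 3) then 3 else 0) / of_real t" if "j \<le> l" for j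
  proof -
    let ?r = "complex_of_real (sqrt 3)"
    have s: "(1 / ?r) ^ (l - j) * (1 / ?r) ^ j = 1 / of_real t"
      by (simp only: power_split[OF that]) (simp add: t_def power_one_over)
    have "(1 / ?r) ^ (l - j) * (c / ?r) ^ j = c ^ j / of_real t" for c
    proof -
      have "(1 / ?r) ^ (l - j) * (c / ?r) ^ j = c ^ j * ((1 / ?r) ^ (l - j) * (1 / ?r) ^ j)"
        by (simp add: power_divide)
      then show ?thesis unfolding s by simp
    qed
    note c = this[of 2] this[of "2 * \<omega>"] this[of "2 * \<omega>\<^sup>2"]
    have "m j = 0 ^ j + ((1 / ?r) ^ (l - j) * (2 / ?r) ^ j +
        ((1 / ?r) ^ (l - j) * (2 * \<omega> / ?r) ^ j + (1 / ?r) ^ (l - j) * (2 * \<omega>\<^sup>2 / ?r) ^ j))"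
      unfolding m_def using distinct distinct[symmetric] by (subst sum.insert; simp)+
    \<comment> \<open>The three representatives differ by powers of \<open>\<omega>\<close>, so
      their sum filters out every j that is not divisible by 3.\<close>
    also have "\<dots> = 0 ^ j + 2 ^ j * (1 + \<omega> ^ j + (\<omega>\<^sup>2) ^ j) / of_real t"
      unfolding c by (simp only: power_mult_distrib add_divide_distrib distrib_left mult_1_right add.assoc)
    finally show ?thesis unfolding sum_powers_omega .
  qed
  have m0: "m 0 = (3 + of_real t) / of_real t"
    using m[of 0] nz by (simp add: field_simps)
  have f: "m j / m 0 = (if [j = 0] (mod 3) then complex_of_real (3 / (3 + t)) * 2 ^ j else 0)"
    if "0 < j" "j \<le> l" for j
    using m[of j] that nz by (auto simp: m0 power_0_left)
  have "G_III = III.G" by (simp add: G_III_def)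
  then show ?thesis
    using III.phi_normalized[of l, folded m_def] assms nz
      homogeneous_sum_pure_power[of "\<lambda>j. m j / m 0" l "\<lambda>j. [j = 0] (mod 3)"
        "complex_of_real (3 / (3 + t))" 2, OF _ f]
    by (simp add: sum_powers_4 m0 t_def Const_numeral del: of_real_divide of_real_add of_real_power)
qed

theorem theorem2p3:
  fixes l :: nat
  shows
    "(odd l \<longrightarrow> \<phi> G_I l = 0) \<and>
     (even l \<and> 0 < l \<longrightarrow>
        \<phi> G_I l \<noteq> 0 \<and>
        \<phi>_normalized G_I l =
          X ^ l + Y ^ l + Const (of_real (2 / (2 + sqrt 2 ^ l))) *
            (\<Sum>j | 0 < j \<and> j < l \<and> [j = 0] (mod 2). of_nat (l choose j) * X ^ (l - j) * Y ^ j)) \<and>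
     (\<not> [l = 0] (mod 4) \<longrightarrow> \<phi> G_III l = 0) \<and>
     ([l = 0] (mod 4) \<longrightarrow>
        \<phi> G_III l \<noteq> 0 \<and>
        \<phi>_normalized G_III l =
          X ^ l + Const (of_real (3 / (3 + sqrt 3 ^ l))) *
            (\<Sum>j | 0 < j \<and> j \<le> l \<and> [j = 0] (mod 3). 2 ^ j * of_nat (l choose j) * X ^ (l - j) * Y ^ j)) \<and>
     (odd l \<longrightarrow> \<phi> G_IV l = 0) \<and>
     (even l \<longrightarrow>
        \<phi> G_IV l \<noteq> 0 \<and>
        \<phi>_normalized G_IV l =
          X ^ l + Const (of_real (2 / (2 + 2 ^ l))) *
            (\<Sum>j | 0 < j \<and> j \<le> l \<and> [j = 0] (mod 2). 3 ^ j * of_nat (l choose j) * X ^ (l - j) * Y ^ j))"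
proof (intro conjI impI)
  show "\<phi> G_I l = 0" if "odd l"
    using I.phi_eq_0[of l] that by (simp add: sum_powers_2 G_I_def)
  show "\<phi> G_III l = 0" if "\<not> [l = 0] (mod 4)"
    using III.phi_eq_0[of l] that by (simp add: sum_powers_4 G_III_def)
  show "\<phi> G_IV l = 0" if "odd l"
    using IV.phi_eq_0[of l] that by (simp add: sum_powers_2 G_IV_def)
qed (use G_I_normalized G_III_normalized G_IV_normalized in auto)

end
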